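(* Let $n, m \ge 1$ be integers and let $P(\lambda)=L\lambda^m+A_{m-1}\lambda^{m-1}+\cdots+A_0$ be an $n \times n$ matrix polynomial, where $L, A_0,\ldots,A_{m-1}\in M_n(\mathbb{C})$ and the leading coefficient matrix $L$ is nonsingular. Let $S(\lambda)= \sum_{i=1}^{n}p_{ii}(\lambda)$, where $p_{ii}(\lambda)$ denotes the $i$th diagonal entry of $P(\lambda)$. If $\lambda_1,\ldots,\lambda_{mn}$ are the eigenvalues of $P(\lambda)$, counted with algebraic multiplicity, then: (1) $\sum_{k=1}^{mn}\lambda_k = -\operatorname{tr}\left(L^{-1}A_{m-1}\right)$; (2) $\prod_{k=1}^{mn}\lambda_k = (-1)^{mn}\det(L^{-1}A_0)$; (3) the sum of the roots of $S(\lambda)$, counted with multiplicity, is $-\dfrac{\operatorname{tr}(A_{m-1})}{\operatorname{tr}(L)}$, provided $\operatorname{tr}(L) \neq 0$.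
   Context: $M_n(\mathbb{C})$ is the set of $n\times n$ complex matrices and $\operatorname{tr}$ denotes the trace. A matrix polynomial $P(\lambda)=\sum_{l=0}^m A_l\lambda^l$ with $A_l=[a_l^{(ij)}]\in M_n(\mathbb{C})$ is viewed as an $n\times n$ matrix $[p_{ij}(\lambda)]$ of scalar polynomials $p_{ij}(\lambda)=\sum_{l=0}^m a_l^{(ij)}\lambda^l$. When the leading coefficient is nonsingular, the eigenvalues of $P(\lambda)$ are the complex numbers $\lambda_0$ with $\det P(\lambda_0)=0$; the algebraic multiplicity of an eigenvalue is its multiplicity as a root of the scalar polynomial $\det P(\lambda)$, and there are exactly $mn$ eigenvalues counted with algebraic multiplicity. *)

theory Defs
  imports "HOL-Analysis.Analysis" "HOL-Computational_Algebra.Computational_Algebra"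
begin

definition matrix_polynomial ::
  "nat \<Rightarrow> complex^'n^'n \<Rightarrow> (nat \<Rightarrow> complex^'n^'n) \<Rightarrow> (complex poly)^'n^'n"
  where "matrix_polynomial m L A =
    (\<chi> i j. monom (L $ i $ j) m + (\<Sum>l<m. monom (A l $ i $ j) l))"

definition mp_eval :: "(complex poly)^'n^'n \<Rightarrow> complex \<Rightarrow> complex^'n^'n"
  where "mp_eval P z = (\<chi> i j. poly (P $ i $ j) z)"

definition mp_eigenvalue :: "(complex poly)^'n^'n \<Rightarrow> complex \<Rightarrow> bool"
  where "mp_eigenvalue P z \<longleftrightarrow> det (mp_eval P z) = 0"

(* Here det P is the scalar polynomial det P(lambda).  The order of the zero polynomial is
   unspecified; det P is nonzero whenever the leading coefficient matrix is nonsingular. *)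
definition mp_alg_mult :: "(complex poly)^'n^'n \<Rightarrow> complex \<Rightarrow> nat"
  where "mp_alg_mult P z = order z (det P)"

(* ev 1, ..., ev N lists all eigenvalues of P, each as often as its algebraic multiplicity. *)
definition mp_eigenvalue_list :: "(complex poly)^'n^'n \<Rightarrow> nat \<Rightarrow> (nat \<Rightarrow> complex) \<Rightarrow> bool"
  where "mp_eigenvalue_list P N ev \<longleftrightarrow>
    (\<forall>k\<in>{1..N}. mp_eigenvalue P (ev k)) \<and>
    (\<forall>z. mp_eigenvalue P z \<longrightarrow> card {k\<in>{1..N}. ev k = z} = mp_alg_mult P z)"

end

theory Submission
  imports Defs
begin

unbundle no Formal_Power_Series.fps_syntax

text \<open>Dividing by the leading coefficient, \<open>det P = det L * det Q\<close> where \<open>Q\<close> is monic with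
  coefficients \<open>L\<^sup>-\<^sup>1 A\<^sub>l\<close>. In the Leibniz expansion of \<open>det Q\<close> every non-identity permutation
  meets at least two off-diagonal entries, each of degree below \<open>m\<close>, so it contributes only in
  degrees at most \<open>mn - 2\<close>; the two top coefficients of \<open>det Q\<close> are thus those of the product of
  its diagonal. Vieta's formulas finish the proof.\<close>

section \<open>Vieta's formulas for complex polynomials\<close>

lemma monic_prod_linear_factors:
  fixes M :: "'a::idom multiset"
  defines "p \<equiv> \<Prod>x\<in>#M. [:-x, 1:]"
  shows "degree p = size M" "lead_coeff p = 1"
proof -
  have "p \<noteq> 0 \<and> degree p = size M \<and> lead_coeff p = 1"
    unfolding p_def
  proof (induction M)
    case empty
    then show ?case by simp
  next
    case (add x M)
    let ?q = "\<Prod>x\<in>#M. [:-x, 1:]"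
    have "lead_coeff ([:-x, 1:] * ?q) = lead_coeff ?q"
      by (subst lead_coeff_mult) simp
    moreover have "degree ([:-x, 1:] * ?q) = Suc (degree ?q)"
      using add.IH by (subst degree_mult_eq) auto
    ultimately show ?case using add.IH by auto
  qed
  then show "degree p = size M" "lead_coeff p = 1" by auto
qed

text \<open>The shift by \<open>pCons 0\<close> avoids the truncated index \<open>size M - 1\<close> for empty \<open>M\<close>.\<close>

lemma coeff_prod_linear_factors:
  fixes M :: "'a::idom multiset"
  shows "coeff (pCons 0 (\<Prod>x\<in>#M. [:-x, 1:])) (size M) = - (\<Sum>x\<in>#M. x)"
proof (induction M)
  case empty
  then show ?case by simp
next
  case (add x M)
  have "coeff (\<Prod>x\<in>#M. [:-x, 1:]) (size M) = 1"
    using monic_prod_linear_factors[of M] by simp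
  with add show ?case by simp
qed

text \<open>Complex polynomials split into linear factors, so this is Vieta's formula for the sum.
  In degree 0 the truncated index \<open>degree p - 1\<close> would make it fail for nonzero
  constants.\<close>

lemma sum_mset_proots_complex:
  fixes p :: "complex poly"
  assumes "degree p \<ge> 1"
  shows "lead_coeff p * (\<Sum>z\<in>#proots p. z) = - coeff p (degree p - 1)"
proof -
  let ?q = "\<Prod>x\<in>#proots p. [:-x, 1:]"
  have "coeff ?q (degree p - 1) = - (\<Sum>z\<in>#proots p. z)"
    using coeff_prod_linear_factors[of "proots p"] assms
    by (simp add: size_proots_complex coeff_pCons split: nat.splits)
  moreover have "coeff p (degree p - 1) = lead_coeff p * coeff ?q (degree p - 1)"
    by (subst complex_poly_decompose_multiset[of p, symmetric]) simp
  ultimately show ?thesis by simp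
qed

lemma prod_mset_proots_complex:
  fixes p :: "complex poly"
  shows "lead_coeff p * (\<Prod>z\<in>#proots p. z) = (-1) ^ degree p * coeff p 0"
proof -
  have prod: "(\<Prod>x\<in>#M. - x) = (-1) ^ size M * (\<Prod>x\<in>#M. x)" for M :: "complex multiset"
    by (induction M) auto
  have "coeff p 0 = poly p 0" by (simp add: poly_0_coeff_0)
  also have "\<dots> = lead_coeff p * ((-1) ^ degree p * (\<Prod>z\<in>#proots p. z))"
    by (subst complex_poly_decompose_multiset[of p, symmetric])
       (simp add: poly_prod_mset prod size_proots_complex image_mset.compositionality o_def)
  \<comment> \<open>A second factor \<open>(-1) ^ degree p\<close> cancels the first and moves the
    sign next to \<open>coeff p 0\<close>.\<close>
  also have "(-1) ^ degree p * \<dots> =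
      ((-1) ^ degree p * (-1) ^ degree p) * (lead_coeff p * (\<Prod>z\<in>#proots p. z))"
    by (simp only: mult_ac)
  also have "\<dots> = lead_coeff p * (\<Prod>z\<in>#proots p. z)"
    by (simp flip: power_mult_distrib)
  finally show ?thesis by simp
qed

text \<open>The next-to-top coefficient of a monic polynomial is minus the sum of its roots, and the
  roots of a product are the multiset union of those of its factors; this makes the coefficient
  additive without expanding the product.\<close>

lemma monic_prod_complex:
  fixes f :: "'b \<Rightarrow> complex poly"
  assumes "finite I" "I \<noteq> {}" "m \<ge> 1"
    and "\<And>i. i \<in> I \<Longrightarrow> degree (f i) = m" "\<And>i. i \<in> I \<Longrightarrow> coeff (f i) m = 1"
  shows "degree (\<Prod>i\<in>I. f i) = m * card I" "lead_coeff (\<Prod>i\<in>I. f i) = 1"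
    and "coeff (\<Prod>i\<in>I. f i) (m * card I - 1) = (\<Sum>i\<in>I. coeff (f i) (m - 1))"
proof -
  let ?p = "\<Prod>i\<in>I. f i"
  have nz: "f i \<noteq> 0" if "i \<in> I" for i using assms(5)[OF that] by auto
  show deg: "degree ?p = m * card I"
    using nz assms by (simp add: degree_prod_eq_sum_degree)
  show lc: "lead_coeff ?p = 1"
    using assms by (simp add: lead_coeff_prod)
  have "coeff (f i) (m - 1) = - (\<Sum>z\<in>#proots (f i). z)" if "i \<in> I" for i
    using sum_mset_proots_complex[of "f i"] assms that by simp
  moreover have "m * card I \<ge> 1"
    using assms by (simp add: Suc_le_eq card_gt_0_iff)
  then have "coeff ?p (m * card I - 1) = - (\<Sum>z\<in>#proots ?p. z)"
    using sum_mset_proots_complex[of ?p] deg lc by simp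
  moreover have "proots ?p = (\<Sum>i\<in>I. proots (f i))"
    using nz by (intro proots_prod) auto
  moreover have "sum_mset (\<Sum>i\<in>J. g i) = (\<Sum>i\<in>J. sum_mset (g i))"
    for J :: "'b set" and g :: "'b \<Rightarrow> complex multiset"
    by (induction J rule: infinite_finite_induct) auto
  ultimately show "coeff ?p (m * card I - 1) = (\<Sum>i\<in>I. coeff (f i) (m - 1))"
    by (simp add: sum_negf)
qed

section \<open>Top coefficients of the determinant\<close>

lemma degree_prod_permutes_less:
  fixes Q :: "complex poly^'n^'n"
  assumes "\<And>i j. degree (Q $ i $ j) \<le> m"
    and "\<And>i j. i \<noteq> j \<Longrightarrow> degree (Q $ i $ j) < m"
    and "p permutes UNIV" "p \<noteq> id"
  shows "degree (\<Prod>i\<in>UNIV. Q $ i $ p i) < m * CARD('n) - 1"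
proof -
  obtain a where a: "p a \<noteq> a" using assms(4) by (auto simp: fun_eq_iff)
  \<comment> \<open>By injectivity \<open>p\<close> moves \<open>p a\<close> as well, so rows
    \<open>a\<close> and \<open>b\<close> both contribute off-diagonal entries.\<close>
  define b where "b = p a"
  have b: "p b \<noteq> b" "a \<noteq> b"
    using a permutes_inj[OF assms(3)] by (auto simp: b_def dest: injD)
  have "degree (\<Prod>i\<in>UNIV. Q $ i $ p i) \<le> (\<Sum>i\<in>UNIV. degree (Q $ i $ p i))"
    using degree_prod_sum_le[of UNIV "\<lambda>i. Q $ i $ p i"] by (simp add: o_def)
  \<comment> \<open>The two lost degrees are added on the left, which avoids truncated
    subtraction.\<close>
  also have "\<dots> + card {a, b} \<le> (\<Sum>i\<in>(UNIV::'n set). m)"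
  proof -
    have "card {a, b} = (\<Sum>i\<in>UNIV. if i \<in> {a, b} then 1 else 0)"
      by (auto simp flip: sum.inter_filter intro!: arg_cong[where f = card])
    then have "(\<Sum>i\<in>UNIV. degree (Q $ i $ p i)) + card {a, b}
        = (\<Sum>i\<in>UNIV. degree (Q $ i $ p i) + (if i \<in> {a, b} then 1 else 0))"
      by (simp add: sum.distrib)
    also have "\<dots> \<le> (\<Sum>i\<in>(UNIV::'n set). m)"
    proof (rule sum_mono)
      fix i
      show "degree (Q $ i $ p i) + (if i \<in> {a, b} then 1 else 0) \<le> m"
        using assms(1)[of i "p i"] assms(2)[of a "p a"] assms(2)[of b "p b"] a b by auto
    qed
    finally show ?thesis .
  qed
  finally show ?thesis using b by (simp add: mult.commute)
qed

lemma monic_det_top_coeffs: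
  fixes Q :: "complex poly^'n^'n"
  assumes m: "m \<ge> 1"
    and diag: "\<And>i. degree (Q $ i $ i) = m" "\<And>i. coeff (Q $ i $ i) m = 1"
    and off: "\<And>i j. i \<noteq> j \<Longrightarrow> degree (Q $ i $ j) < m"
  shows "degree (det Q) = m * CARD('n)" "lead_coeff (det Q) = 1"
    and "coeff (det Q) (m * CARD('n) - 1) = (\<Sum>i\<in>UNIV. coeff (Q $ i $ i) (m - 1))"
proof -
  let ?N = "m * CARD('n)" and ?D = "\<Prod>i\<in>UNIV. Q $ i $ i"
  define R where "R = (\<Sum>p\<in>{p. p permutes UNIV} - {id}.
      of_int (sign p) * (\<Prod>i\<in>UNIV. Q $ i $ p i))"
  have le: "degree (Q $ i $ j) \<le> m" for i j
    using diag(1)[of i] off[of i j] by (cases "i = j") auto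
  have "det Q = ?D + R"
    unfolding det_def R_def
    by (subst sum.remove[of _ id]) (auto simp: finite_permutations permutes_id)
  \<comment> \<open>The range includes both \<open>?N - 1\<close> and \<open>?N\<close>, and also
    all higher indices, which the bound on the degree of \<open>det Q\<close> uses.\<close>
  moreover have "coeff R k = 0" if "k \<ge> ?N - 1" for k
    unfolding R_def coeff_sum
  proof (intro sum.neutral ballI)
    fix p :: "'n \<Rightarrow> 'n" assume "p \<in> {p. p permutes UNIV} - {id}"
    then have "degree (\<Prod>i\<in>UNIV. Q $ i $ p i) < k"
      using degree_prod_permutes_less[OF le off, of p] that by auto
    then show "coeff (of_int (sign p) * (\<Prod>i\<in>UNIV. Q $ i $ p i)) k = 0"
      by (simp add: of_int_poly coeff_eq_0)
  qed
  ultimately have top: "coeff (det Q) k = coeff ?D k" if "k \<ge> ?N - 1" for k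
    using that by simp
  note D = monic_prod_complex[of UNIV m "\<lambda>i. Q $ i $ i", OF _ _ m diag, simplified]
  show deg: "degree (det Q) = ?N"
  proof (rule antisym)
    show "degree (det Q) \<le> ?N"
      using top D(1) by (intro degree_le) (auto simp: coeff_eq_0)
    show "?N \<le> degree (det Q)"
      using top[of ?N] D(1,2) by (intro le_degree) simp
  qed
  show "lead_coeff (det Q) = 1" using deg top[of ?N] D(1,2) by simp
  show "coeff (det Q) (?N - 1) = (\<Sum>i\<in>UNIV. coeff (Q $ i $ i) (m - 1))"
    using top[of "?N - 1"] D(3) by simp
qed

section \<open>Determinants of matrix polynomials\<close>

lemma coeff_matrix_polynomial:
  "coeff (matrix_polynomial m L A $ i $ j) k =
    (if k = m then L $ i $ j else if k < m then A k $ i $ j else 0)"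
  by (simp add: matrix_polynomial_def coeff_sum)

lemma degree_matrix_polynomial_le: "degree (matrix_polynomial m L A $ i $ j) \<le> m"
  by (intro degree_le) (auto simp: coeff_matrix_polynomial)

lemma poly_det: "poly (det P) z = det (mp_eval P z)"
  by (simp add: det_def mp_eval_def poly_sum poly_prod of_int_poly)

lemma mp_eval_matrix_polynomial_mult:
  "mp_eval (matrix_polynomial m (L ** M) (\<lambda>l. L ** B l)) z = L ** mp_eval (matrix_polynomial m M B) z"
proof -
  have "(\<Sum>l<m. (\<Sum>k\<in>UNIV. L $ i $ k * B l $ k $ j) * z ^ l)
      = (\<Sum>k\<in>UNIV. L $ i $ k * (\<Sum>l<m. B l $ k $ j * z ^ l))" for i j
    by (simp add: sum_distrib_left sum_distrib_right mult.assoc) (rule sum.swap)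
  then show ?thesis
    by (simp add: vec_eq_iff mp_eval_def matrix_polynomial_def matrix_matrix_mult_def poly_sum
        poly_monom sum_distrib_right distrib_left sum.distrib mult.assoc)
qed

text \<open>Complex polynomials are determined by their values, and at each point \<open>L\<close>
  factors out of a product of complex matrices.\<close>

lemma det_matrix_polynomial_mult:
  "det (matrix_polynomial m (L ** M) (\<lambda>l. L ** B l)) = smult (det L) (det (matrix_polynomial m M B))"
  by (rule poly_eq_poly_eq_iff[THEN iffD1])
     (simp add: fun_eq_iff poly_det mp_eval_matrix_polynomial_mult det_mul)

lemma monic_matrix_polynomial_det:
  fixes B :: "nat \<Rightarrow> complex^'n^'n"
  assumes "m \<ge> 1"
  defines "q \<equiv> det (matrix_polynomial m (mat 1) B)"
  shows "degree q = m * CARD('n)" "lead_coeff q = 1"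
    and "coeff q (m * CARD('n) - 1) = trace (B (m - 1))" "coeff q 0 = det (B 0)"
proof -
  let ?Q = "matrix_polynomial m (mat 1) B"
  have 1: "degree (?Q $ i $ i) = m" for i
    by (intro antisym degree_matrix_polynomial_le le_degree)
       (simp add: coeff_matrix_polynomial mat_def)
  have 2: "coeff (?Q $ i $ i) m = 1" for i
    by (simp add: coeff_matrix_polynomial mat_def)
  have 3: "degree (?Q $ i $ j) < m" if "i \<noteq> j" for i j
  proof -
    have "degree (?Q $ i $ j) \<le> m - 1"
      using that by (intro degree_le) (auto simp: coeff_matrix_polynomial mat_def)
    with assms show ?thesis by simp
  qed
  note top = monic_det_top_coeffs[OF assms(1), of ?Q, OF 1 2 3]
  show "degree q = m * CARD('n)" "lead_coeff q = 1" using top(1,2) by (simp_all add: q_def)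
  show "coeff q (m * CARD('n) - 1) = trace (B (m - 1))"
    using top(3) assms(1) by (auto simp: q_def coeff_matrix_polynomial trace_def intro!: sum.cong)
  \<comment> \<open>The constant coefficient is the value at 0, where only the term with index 0
    survives because \<open>m \<ge> 1\<close>.\<close>
  have "mp_eval ?Q 0 = B 0"
    using assms(1)
    by (simp add: vec_eq_iff mp_eval_def poly_0_coeff_0 coeff_matrix_polynomial)
  then have "poly q 0 = det (B 0)" by (simp only: q_def poly_det)
  then show "coeff q 0 = det (B 0)" by (simp only: poly_0_coeff_0)
qed

text \<open>This turns the indexed list into the multiset of roots that Vieta's formulas speak
  of.\<close>

lemma proots_det_eq_eigenvalues:
  assumes "mp_eigenvalue_list P N ev" "det P \<noteq> 0"
  shows "proots (det P) = image_mset ev (mset_set {1..N})"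
proof (rule multiset_eqI)
  fix z
  have count: "count (image_mset ev (mset_set {1..N})) z = card {k\<in>{1..N}. ev k = z}"
    by (auto simp: count_image_mset' simp flip: card_eq_sum intro!: arg_cong[where f = card])
  show "count (proots (det P)) z = count (image_mset ev (mset_set {1..N})) z"
  proof (cases "mp_eigenvalue P z")
    case True
    then show ?thesis
      using assms count by (simp add: mp_eigenvalue_list_def mp_alg_mult_def)
  next
    case False
    \<comment> \<open>The counting clause covers eigenvalues only; elsewhere the membership clause
      makes the count 0.\<close>
    then have "{k\<in>{1..N}. ev k = z} = {}"
      using assms(1) by (auto simp: mp_eigenvalue_list_def)
    moreover have "order z (det P) = 0"
      using False order_root[of "det P" z] by (simp add: mp_eigenvalue_def poly_det)
    ultimately show ?thesis using assms(2) count by simp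
  qed
qed

theorem theorem3p5:
  fixes m :: nat
    and L :: "complex^'n^'n"
    and A :: "nat \<Rightarrow> complex^'n^'n"
    and P :: "(complex poly)^'n^'n"
    and S :: "complex poly"
    and ev :: "nat \<Rightarrow> complex"
  assumes "m \<ge> 1"
    and "invertible L"
    and "P = matrix_polynomial m L A"
    and "S = (\<Sum>i\<in>UNIV. P $ i $ i)"
    and "mp_eigenvalue_list P (m * CARD('n)) ev"
  shows "(\<Sum>k=1..m * CARD('n). ev k) = - trace (matrix_inv L ** A (m - 1)) \<and>
    (\<Prod>k=1..m * CARD('n). ev k) = (-1) ^ (m * CARD('n)) * det (matrix_inv L ** A 0) \<and>
    (trace L \<noteq> 0 \<longrightarrow> (\<Sum>z\<in>#proots S. z) = - (trace (A (m - 1)) / trace L))"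
proof (intro conjI impI)
  let ?N = "m * CARD('n)" and ?B = "\<lambda>l. matrix_inv L ** A l"
  let ?q = "det (matrix_polynomial m (mat 1) ?B)"
  note q = monic_matrix_polynomial_det[OF assms(1), of ?B]
  \<comment> \<open>\<open>matrix_inv\<close> is defined by choice, so existence of an inverse
    yields its property.\<close>
  have inv: "L ** matrix_inv L = mat 1"
    using someI_ex[OF assms(2)[unfolded invertible_def]] by (simp add: matrix_inv_def)
  have detL: "det L \<noteq> 0"
    using assms(2) by (simp add: invertible_det_nz)
  have "det P = smult (det L) ?q"
    using det_matrix_polynomial_mult[of m L "mat 1" ?B]
    by (simp add: assms(3) matrix_mul_assoc inv)
  moreover have "?q \<noteq> 0" using q(2) by auto
  \<comment> \<open>The nonzero scalar \<open>det L\<close> does not change the roots, so those of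
    the monic \<open>?q\<close> are the eigenvalues of \<open>P\<close>.\<close>
  ultimately have roots: "proots ?q = image_mset ev (mset_set {1..?N})"
    using proots_det_eq_eigenvalues[OF assms(5)] detL by simp
  have "?N \<ge> 1" using assms(1) by (simp add: Suc_le_eq)
  then show "(\<Sum>k=1..?N. ev k) = - trace (matrix_inv L ** A (m - 1))"
    using sum_mset_proots_complex[of ?q] q(1,2,3) roots by (simp add: sum_unfold_sum_mset)
  show "(\<Prod>k=1..?N. ev k) = (-1) ^ ?N * det (matrix_inv L ** A 0)"
    using prod_mset_proots_complex[of ?q] q(1,2,4) roots by (simp add: prod_unfold_prod_mset)
  assume tr: "trace L \<noteq> 0"
  have S: "coeff S k = (if k = m then trace L else if k < m then trace (A k) else 0)" for k
    by (simp add: assms(3,4) coeff_sum coeff_matrix_polynomial trace_def)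
  \<comment> \<open>The coefficient of index \<open>m\<close> is \<open>trace L\<close>, so a
    nonzero trace fixes the degree.\<close>
  then have "degree S = m"
    using tr by (intro antisym degree_le le_degree) auto
  moreover have "coeff S m = trace L" "coeff S (m - 1) = trace (A (m - 1))"
    using S assms(1) by auto
  ultimately show "(\<Sum>z\<in>#proots S. z) = - (trace (A (m - 1)) / trace L)"
    using sum_mset_proots_complex[of S] assms(1) tr by (simp add: field_simps)
qed

end
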